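(* Let $n\geq 10$ be an even integer. There exists a latin square of order $n$ with at least $\lfloor n/6\rfloor$ pinned entries.
   Context: A latin square of order $n$ is an $n\times n$ array on $n$ symbols in which each symbol occurs exactly once in each row and each column; it is viewed as the set of $n^2$ entries $(r,c,s)$, meaning symbol $s$ is in row $r$, column $c$. A transversal is a set of $n$ entries containing each row, each column and each symbol exactly once. An entry is pinned if the latin square has at least one transversal and the entry belongs to every transversal. *)

theory Defs
  imports Main
begin

text \<open>A latin square of order n on rows, columns and symbols 0..n-1, viewed as the
set of its n^2 entries (r,c,s): symbol s is in row r, column c.\<close>
definition latin_square :: "nat \<Rightarrow> (nat \<times> nat \<times> nat) set \<Rightarrow> bool" where
  "latin_square n L \<longleftrightarrow>
     L \<subseteq> {0..<n} \<times> {0..<n} \<times> {0..<n} \<and>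
     (\<forall>r<n. \<forall>c<n. \<exists>!s. (r, c, s) \<in> L) \<and>
     (\<forall>r<n. \<forall>s<n. \<exists>!c. (r, c, s) \<in> L) \<and>
     (\<forall>c<n. \<forall>s<n. \<exists>!r. (r, c, s) \<in> L)"

definition transversal :: "nat \<Rightarrow> (nat \<times> nat \<times> nat) set \<Rightarrow> (nat \<times> nat \<times> nat) set \<Rightarrow> bool" where
  "transversal n L T \<longleftrightarrow>
     T \<subseteq> L \<and> card T = n \<and>
     (\<forall>r<n. \<exists>!e. e \<in> T \<and> fst e = r) \<and>
     (\<forall>c<n. \<exists>!e. e \<in> T \<and> fst (snd e) = c) \<and>
     (\<forall>s<n. \<exists>!e. e \<in> T \<and> snd (snd e) = s)"

definition pinned :: "nat \<Rightarrow> (nat \<times> nat \<times> nat) set \<Rightarrow> (nat \<times> nat \<times> nat) \<Rightarrow> bool" where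
  "pinned n L e \<longleftrightarrow> e \<in> L \<and> (\<exists>T. transversal n L T) \<and> (\<forall>T. transversal n L T \<longrightarrow> e \<in> T)"

end

theory Submission
  imports Defs "HOL-Number_Theory.Cong"
begin

text \<open>Write the symbol in cell \<open>(r, c)\<close> as \<open>K r c + c\<close> modulo \<open>n\<close>. Summing over a transversal shows
  that \<open>n\<close> divides the sum of the values \<open>K r c\<close> of its cells. If the diagonal is a transversal on
  which every \<open>K r\<close> attains its maximum, and the sum over all rows of maximum minus minimum is less
  than \<open>n\<close>, then every transversal attains the maximum in each row; a row with a unique maximum
  thus yields a pinned entry.

  Such squares arise from the cyclic square (\<open>K r c = r\<close>) by trades. Replacing three consecutive
  rows by the rows \<open>block_row\<close> below costs a spread of 6 and yields one pinned entry, which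
  accounts for the bound \<open>n div 6\<close>. One exceptional group of four to six rows, depending on
  \<open>n\<close> modulo 6, makes the spread drop below \<open>n\<close>, and permuting the remaining rows makes the
  diagonal a transversal.\<close>

section \<open>Latin squares described by shifts\<close>

text \<open>\<open>K\<close> is natural-valued rather than a residue because the pinning argument
  compares sizes of sums of \<open>K\<close>, not only their classes modulo
  \<open>n\<close>.\<close>

definition shift_square :: "nat \<Rightarrow> (nat \<Rightarrow> nat \<Rightarrow> nat) \<Rightarrow> (nat \<times> nat \<times> nat) set" where
  "shift_square n K = {(r, c, s). r < n \<and> c < n \<and> s = (K r c + c) mod n}"

lemma inj_on_mod_shift:
  fixes k :: "nat \<Rightarrow> nat"
  assumes "\<And>i. i \<in> A \<Longrightarrow> k i < n" and "inj_on k A"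
  shows "inj_on (\<lambda>i. (k i + c) mod n) A"
proof (rule inj_onI)
  fix i j assume "i \<in> A" "j \<in> A" and eq: "(k i + c) mod n = (k j + c) mod n"
  from eq have "[k i = k j] (mod n)"
    using cong_add_rcancel_nat unfolding cong_def by blast
  hence "k i = k j"
    using assms(1) \<open>i \<in> A\<close> \<open>j \<in> A\<close> by (auto simp: cong_def)
  thus "i = j" using assms(2) \<open>i \<in> A\<close> \<open>j \<in> A\<close> by (auto dest: inj_onD)
qed

lemma inj_on_lessThan_ex1:
  fixes f :: "nat \<Rightarrow> nat"
  assumes "inj_on f {..<n}" and "\<And>i. i < n \<Longrightarrow> f i < n" and "s < n"
  shows "\<exists>!i. i < n \<and> s = f i"
proof -
  have "f ` {..<n} \<subseteq> {..<n}" using assms(2) by auto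
  hence "f ` {..<n} = {..<n}" using assms(1) by (intro endo_inj_surj) auto
  with assms(3) obtain i where "i < n" "s = f i" by (metis imageE lessThan_iff)
  thus ?thesis using assms(1) by (metis inj_onD lessThan_iff)
qed

text \<open>Down a column the symbols are a translate of the values of \<open>K\<close>, so distinct
  values below \<open>n\<close> suffice; along a row the translation varies, so injectivity modulo
  \<open>n\<close> is demanded directly. Existence follows since injective self-maps of a finite set
  are onto.\<close>

lemma latin_shift_square:
  assumes bound: "\<And>r c. r < n \<Longrightarrow> c < n \<Longrightarrow> K r c < n"
    and col: "\<And>c. c < n \<Longrightarrow> inj_on (\<lambda>r. K r c) {..<n}"
    and row: "\<And>r. r < n \<Longrightarrow> inj_on (\<lambda>c. (K r c + c) mod n) {..<n}"
  shows "latin_square n (shift_square n K)"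
  unfolding latin_square_def
proof (intro conjI allI impI)
  show "shift_square n K \<subseteq> {0..<n} \<times> {0..<n} \<times> {0..<n}"
    by (auto simp: shift_square_def)
next
  fix r c assume "r < n" "c < n"
  thus "\<exists>!s. (r, c, s) \<in> shift_square n K" by (auto simp: shift_square_def)
next
  fix r s assume *: "r < n" "s < n"
  have "\<exists>!c. c < n \<and> s = (K r c + c) mod n"
    by (rule inj_on_lessThan_ex1[OF row]) (use * in auto)
  thus "\<exists>!c. (r, c, s) \<in> shift_square n K" using * by (simp add: shift_square_def)
next
  fix c s assume *: "c < n" "s < n"
  have "inj_on (\<lambda>r. (K r c + c) mod n) {..<n}"
    by (rule inj_on_mod_shift) (use bound col * in auto)
  hence "\<exists>!r. r < n \<and> s = (K r c + c) mod n"
    by (rule inj_on_lessThan_ex1) (use * in auto)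
  thus "\<exists>!r. (r, c, s) \<in> shift_square n K" using * by (simp add: shift_square_def)
qed

section \<open>Transversals and the sum of their shifts\<close>

lemma bij_betw_lessThan_if_ex1:
  assumes "f ` T \<subseteq> {..<n}" and "\<forall>i<n. \<exists>!e. e \<in> T \<and> f e = i"
  shows "bij_betw f T {..<n}"
  unfolding bij_betw_def
proof
  show "inj_on f T" using assms by (intro inj_onI) (metis image_subset_iff lessThan_iff)
  show "f ` T = {..<n}" using assms by blast
qed

text \<open>These bijections let sums over \<open>T\<close> be reindexed as sums over all rows,
  columns or symbols.\<close>

lemma transversal_bij_betw:
  assumes T: "transversal n (shift_square n K) T"
  shows "bij_betw fst T {..<n}"
    and "bij_betw (\<lambda>e. fst (snd e)) T {..<n}"
    and "bij_betw (\<lambda>e. snd (snd e)) T {..<n}"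
proof -
  have sub: "T \<subseteq> shift_square n K"
    and ex: "\<forall>r<n. \<exists>!e. e \<in> T \<and> fst e = r" "\<forall>c<n. \<exists>!e. e \<in> T \<and> fst (snd e) = c"
      "\<forall>s<n. \<exists>!e. e \<in> T \<and> snd (snd e) = s"
    using T unfolding transversal_def by - (elim conjE; assumption)+
  have "fst ` T \<subseteq> {..<n}" "(\<lambda>e. fst (snd e)) ` T \<subseteq> {..<n}" "(\<lambda>e. snd (snd e)) ` T \<subseteq> {..<n}"
    using sub by (auto simp: shift_square_def)
  thus "bij_betw fst T {..<n}" "bij_betw (\<lambda>e. fst (snd e)) T {..<n}"
    "bij_betw (\<lambda>e. snd (snd e)) T {..<n}"
    using ex by (simp_all only: bij_betw_lessThan_if_ex1)
qed

text \<open>Summing \<open>s \<equiv> K r c + c\<close> over a transversal, columns and symbols cancel.\<close>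
lemma transversal_sum_dvd:
  assumes T: "transversal n (shift_square n K) T"
  shows "n dvd (\<Sum>e\<in>T. K (fst e) (fst (snd e)))"
proof -
  have sub: "T \<subseteq> shift_square n K" using T by (simp add: transversal_def)
  note col = transversal_bij_betw(2)[OF T] and sym = transversal_bij_betw(3)[OF T]
  have eq: "snd (snd e) = (K (fst e) (fst (snd e)) + fst (snd e)) mod n" if "e \<in> T" for e
    using sub that by (auto simp: shift_square_def)
  have "(\<Sum>e\<in>T. K (fst e) (fst (snd e))) + (\<Sum>e\<in>T. fst (snd e))
        = (\<Sum>e\<in>T. K (fst e) (fst (snd e)) + fst (snd e))"
    by (simp add: sum.distrib)
  also have "[\<dots> = (\<Sum>e\<in>T. snd (snd e))] (mod n)"
    by (rule cong_sum) (simp add: eq cong_def)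
  also have "(\<Sum>e\<in>T. snd (snd e)) = (\<Sum>e\<in>T. fst (snd e))"
    using sum.reindex_bij_betw[OF col, of "\<lambda>x. x"] sum.reindex_bij_betw[OF sym, of "\<lambda>x. x"]
    by simp
  finally have "[(\<Sum>e\<in>T. K (fst e) (fst (snd e))) + (\<Sum>e\<in>T. fst (snd e))
       = 0 + (\<Sum>e\<in>T. fst (snd e))] (mod n)" by simp
  hence "[(\<Sum>e\<in>T. K (fst e) (fst (snd e))) = 0] (mod n)"
    using cong_add_rcancel_nat by blast
  thus ?thesis by (simp add: cong_0_iff)
qed

section \<open>Pinning along the diagonal\<close>

definition diagonal :: "nat \<Rightarrow> (nat \<Rightarrow> nat \<Rightarrow> nat) \<Rightarrow> (nat \<times> nat \<times> nat) set" where
  "diagonal n K = (\<lambda>r. (r, r, (K r r + r) mod n)) ` {..<n}"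

lemma transversal_diagonal:
  assumes inj: "inj_on (\<lambda>r. (K r r + r) mod n) {..<n}"
  shows "transversal n (shift_square n K) (diagonal n K)"
  unfolding transversal_def
proof (intro conjI allI impI)
  show "diagonal n K \<subseteq> shift_square n K" by (auto simp: diagonal_def shift_square_def)
  show "card (diagonal n K) = n"
    unfolding diagonal_def by (subst card_image) (auto simp: inj_on_def)
next
  fix r assume "r < n"
  thus "\<exists>!e. e \<in> diagonal n K \<and> fst e = r" by (auto simp: diagonal_def)
next
  fix r assume "r < n"
  thus "\<exists>!e. e \<in> diagonal n K \<and> fst (snd e) = r" by (auto simp: diagonal_def)
next
  fix s assume "s < n"
  hence ex1: "\<exists>!r. r < n \<and> s = (K r r + r) mod n"
    by (intro inj_on_lessThan_ex1[OF inj]) auto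
  then obtain r where r: "r < n" "s = (K r r + r) mod n" by blast
  show "\<exists>!e. e \<in> diagonal n K \<and> snd (snd e) = s"
  proof
    show "(r, r, s) \<in> diagonal n K \<and> snd (snd (r, r, s)) = s"
      using r by (auto simp: diagonal_def)
    fix e assume e: "e \<in> diagonal n K \<and> snd (snd e) = s"
    then obtain q where q: "q < n" "e = (q, q, (K q q + q) mod n)"
      by (auto simp: diagonal_def)
    have "q = r" using ex1 r q e by (metis snd_conv)
    thus "e = (r, r, s)" using q(2) r(2) by blast
  qed
qed

text \<open>The totals of \<open>K\<close> over \<open>T\<close> and over the diagonal are multiples
  of \<open>n\<close>. The first is at most the second and \<open>w\<close> keeps the gap below
  \<open>n\<close>, so they agree. Hence every cell of \<open>T\<close> attains its row maximum,
  which in row \<open>p\<close> only the diagonal cell does.\<close>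

lemma pinned_diagonal:
  assumes inj: "inj_on (\<lambda>r. (K r r + r) mod n) {..<n}"
    and le: "\<And>r c. r < n \<Longrightarrow> c < n \<Longrightarrow> K r c \<le> K r r"
    and spread: "\<And>r c. r < n \<Longrightarrow> c < n \<Longrightarrow> K r r \<le> K r c + w r"
    and small: "(\<Sum>r<n. w r) < n"
    and p: "p < n" and strict: "\<And>c. c < n \<Longrightarrow> c \<noteq> p \<Longrightarrow> K p c < K p p"
  shows "pinned n (shift_square n K) (p, p, (K p p + p) mod n)"
  unfolding pinned_def
proof (intro conjI allI impI)
  show "(p, p, (K p p + p) mod n) \<in> shift_square n K" using p by (simp add: shift_square_def)
  have diag: "transversal n (shift_square n K) (diagonal n K)"
    by (rule transversal_diagonal) (rule inj)
  thus "\<exists>T. transversal n (shift_square n K) T" by blast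
  fix T assume T: "transversal n (shift_square n K) T"
  hence sub: "T \<subseteq> shift_square n K" by (simp add: transversal_def)
  note row = transversal_bij_betw(1)[OF T]
  have fin: "finite T" using row by (simp add: bij_betw_finite)
  have lt: "fst e < n" "fst (snd e) < n" if "e \<in> T" for e
    using sub that by (auto simp: shift_square_def)
  let ?S = "\<Sum>e\<in>T. K (fst e) (fst (snd e))" and ?D = "\<Sum>e\<in>T. K (fst e) (fst e)"
  \<comment> \<open>The diagonal total is indexed by \<open>T\<close> through its rows, so that both
    totals can be compared entry by entry.\<close>
  have D: "(\<Sum>r<n. K r r) = ?D"
    using sum.reindex_bij_betw[OF row, of "\<lambda>r. K r r"] by simp
  have "(\<Sum>e\<in>diagonal n K. K (fst e) (fst (snd e))) = (\<Sum>r<n. K r r)"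
    unfolding diagonal_def by (subst sum.reindex) (auto simp: inj_on_def)
  hence "n dvd ?D" using transversal_sum_dvd[OF diag] D by simp
  moreover have "n dvd ?S" by (rule transversal_sum_dvd[OF T])
  moreover have SD: "?S \<le> ?D" by (rule sum_mono) (use le lt in auto)
  moreover have "?D < ?S + n"
  proof -
    have "?D \<le> (\<Sum>e\<in>T. K (fst e) (fst (snd e)) + w (fst e))"
      by (rule sum_mono) (use spread lt in auto)
    also have "\<dots> = ?S + (\<Sum>r<n. w r)"
      using sum.reindex_bij_betw[OF row, of w] by (simp add: sum.distrib)
    finally show ?thesis using small by simp
  qed
  ultimately have "n dvd ?D - ?S" "?D - ?S < n" by (auto intro: dvd_diff_nat)
  with SD have eq: "?S = ?D" using nat_dvd_not_less[of "?D - ?S" n] by linarith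
  have "p \<in> fst ` T" using bij_betw_imp_surj_on[OF row] p by simp
  then obtain e where e: "e \<in> T" "fst e = p" by blast
  have "K (fst e) (fst (snd e)) = K (fst e) (fst e)"
  proof (rule ccontr)
    assume "K (fst e) (fst (snd e)) \<noteq> K (fst e) (fst e)"
    hence "K (fst e) (fst (snd e)) < K (fst e) (fst e)"
      using le[OF lt[OF e(1)]] by linarith
    hence "?S < ?D" using fin e(1) le lt by (intro sum_strict_mono_ex1) blast+
    thus False using eq by simp
  qed
  hence "fst (snd e) = p" using strict[OF lt(2)[OF e(1)]] e(2) by (metis less_irrefl)
  moreover have "snd (snd e) = (K (fst e) (fst (snd e)) + fst (snd e)) mod n"
    using sub e(1) by (auto simp: shift_square_def)
  ultimately have "e = (p, p, (K p p + p) mod n)" using e(2) by (simp add: prod_eq_iff)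
  thus "(p, p, (K p p + p) mod n) \<in> T" using e(1) by simp
qed

section \<open>Rows of the three-row trade\<close>

text \<open>With \<open>t = c - x\<close> modulo \<open>n\<close> the symbol is
  \<open>k t + t + 2 * x\<close>: one \<open>x\<close> comes from the values, one from the columns,
  and a constant translation preserves injectivity. The form \<open>c + n - x\<close> avoids
  truncated subtraction.\<close>

lemma inj_on_row_shift:
  fixes k :: "nat \<Rightarrow> nat"
  assumes inj: "inj_on (\<lambda>t. (k t + t) mod n) {..<n}" and x: "x \<le> n"
  shows "inj_on (\<lambda>c. (x + k ((c + n - x) mod n) + c) mod n) {..<n}"
proof (rule inj_onI)
  fix c d assume c: "c \<in> {..<n}" and d: "d \<in> {..<n}"
    and eq: "(x + k ((c + n - x) mod n) + c) mod n = (x + k ((d + n - x) mod n) + d) mod n"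
  have n: "n > 0" using c by auto
  have red: "[x + k ((c + n - x) mod n) + c
      = (k ((c + n - x) mod n) + (c + n - x) mod n) + 2 * x] (mod n)" for c
  proof -
    have "[(c + n - x) mod n + x = c + n - x + x] (mod n)" by (simp add: cong_def mod_simps)
    hence "[(c + n - x) mod n + x = c] (mod n)" using x by (simp add: cong_def)
    hence "[((c + n - x) mod n + x) + (k ((c + n - x) mod n) + x)
         = c + (k ((c + n - x) mod n) + x)] (mod n)" by (rule cong_add) simp
    thus ?thesis unfolding mult_2 by (simp add: cong_sym_eq algebra_simps)
  qed
  let ?t = "(c + n - x) mod n" and ?u = "(d + n - x) mod n"
  have "[(k ?t + ?t) + 2 * x = (k ?u + ?u) + 2 * x] (mod n)"
    using red[of c] red[of d] eq by (simp add: cong_def)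
  hence "[k ?t + ?t = k ?u + ?u] (mod n)" using cong_add_rcancel_nat by blast
  hence "?t = ?u" using inj n by (auto simp: cong_def dest: inj_onD)
  hence "[c + n - x = d + n - x] (mod n)" by (simp add: cong_def)
  hence "[c + n - x + x = d + n - x + x] (mod n)" by (rule cong_add) simp
  hence "[c = d] (mod n)" using x by (simp add: cong_def)
  thus "c = d" using c d by (simp add: cong_def)
qed

text \<open>Row 0 is the row with constant value 1 after swapping the symbols in columns 0 and 1, so
  its maximum 2 occurs once. Rows 1 and 2 absorb the change by alternating 0 and 2, which closes up
  cyclically for even \<open>n\<close>. All three rows have value 2 on the local diagonal.\<close>

definition block_row :: "nat \<Rightarrow> nat \<Rightarrow> nat" where
  "block_row j t =
     (if j = 0 then if t = 0 then 2 else if t = 1 then 0 else 1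
      else if j = 1 then if even t then 0 else 2
      else if t \<le> 1 then 1 else if even t then 2 else 0)"

lemma block_row_less: "block_row j t < 3"
  by (simp add: block_row_def)

lemma inj_on_block_row: "inj_on (\<lambda>j. block_row j t) {..<3}"
  by (auto simp: inj_on_def block_row_def split: if_splits; presburger)

text \<open>Values below \<open>2 * n\<close> with equal residues are equal or differ by exactly
  \<open>n\<close>; this turns injectivity modulo \<open>n\<close> into linear arithmetic.\<close>

lemma inj_on_mod_if_no_wrap:
  fixes f :: "nat \<Rightarrow> nat"
  assumes "\<And>t. t < n \<Longrightarrow> f t < n + n"
    and "\<And>t u. t < n \<Longrightarrow> u < n \<Longrightarrow> f t = f u \<Longrightarrow> t = u"
    and "\<And>t u. t < n \<Longrightarrow> u < n \<Longrightarrow> f t \<noteq> f u + n"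
  shows "inj_on (\<lambda>t. f t mod n) {..<n}"
proof (rule inj_onI)
  fix t u assume t: "t \<in> {..<n}" and u: "u \<in> {..<n}" and eq: "f t mod n = f u mod n"
  have "f x mod n = (if f x < n then f x else f x - n)" if "x < n" for x
    using assms(1)[OF that] by (simp add: mod_if)
  hence "f t = f u \<or> f t = f u + n \<or> f u = f t + n"
    using eq t u by (auto split: if_splits)
  thus "t = u" using assms(2,3) t u by blast
qed

lemma inj_on_block_row_shift:
  assumes "even n" "n \<ge> 4" "j < 3"
  shows "inj_on (\<lambda>t. (block_row j t + t) mod n) {..<n}"
proof (rule inj_on_mod_if_no_wrap)
  fix t u assume "t < n" "u < n"
  show "block_row j t + t < n + n"
    using block_row_less[of j t] \<open>t < n\<close> assms(2) by linarith
  consider "j = 0" | "j = 1" | "j = 2" using assms(3) by linarith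
  note j = this
  show "t = u" if "block_row j t + t = block_row j u + u"
    using j that by cases (auto simp: block_row_def split: if_splits; presburger)+
  show "block_row j t + t \<noteq> block_row j u + u + n"
    using j \<open>t < n\<close> \<open>u < n\<close> assms
    by cases (auto simp: block_row_def split: if_splits; presburger)+
qed

section \<open>Layout of a square by groups of rows\<close>

text \<open>The rows are grouped, from top to bottom, into \<open>m\<close> triples with constant \<open>K r\<close>, a group of
  \<open>g\<close> rows given by \<open>S\<close>, \<open>b\<close> triples given by \<open>block_row\<close>, and \<open>h\<close> rows with constant \<open>K r\<close>
  given by \<open>R\<close>. The values of \<open>K\<close> in each column permute each group, and in a group starting
  at \<open>x\<close> columns are counted from \<open>x\<close>, so that cell \<open>(x + j, x + j)\<close> has local coordinates
  \<open>(j, j)\<close>. The function \<open>v\<close> lists the diagonal symbols of the parts \<open>S\<close> and \<open>R\<close>; the equation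
  \<open>balance\<close> makes those of the \<open>block_row\<close> part start at 4.\<close>

locale layout =
  fixes n m g b h :: nat and S :: "nat \<Rightarrow> nat \<Rightarrow> nat" and R v w :: "nat \<Rightarrow> nat"
  assumes n_eq: "n = 3 * m + g + 3 * b + h" and n_even: "even n" and n_ge: "n \<ge> 4"
    and balance: "6 * m + 2 * g = n + 2"
    and S_less: "\<And>j t. j < g \<Longrightarrow> t < n \<Longrightarrow> S j t < g"
    and S_col: "\<And>t. t < n \<Longrightarrow> inj_on (\<lambda>j. S j t) {..<g}"
    and S_row: "\<And>j. j < g \<Longrightarrow> inj_on (\<lambda>t. (S j t + t) mod n) {..<n}"
    and S_le: "\<And>j t. j < g \<Longrightarrow> t < n \<Longrightarrow> S j t \<le> S j j"
    and S_spread: "\<And>j t. j < g \<Longrightarrow> t < n \<Longrightarrow> S j j \<le> S j t + w j"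
    and R_less: "\<And>j. j < h \<Longrightarrow> R j < h" and R_inj: "inj_on R {..<h}"
    and small: "6 * b + (\<Sum>j<g. w j) < n"
    and sym_S: "\<And>j. j < g \<Longrightarrow> 6 * m + S j j + j = v j \<or> 6 * m + S j j + j = n + v j"
    and sym_R: "\<And>j. j < h \<Longrightarrow> 2 * (3 * m + g + 3 * b) + R j + j = n + v (g + j)"
    and v_less: "\<And>j. j < g + h \<Longrightarrow> v j < n" and v_inj: "inj_on v {..<g + h}"
    and v_avoid: "\<And>j. j < g + h \<Longrightarrow> v j \<notin> {1..6 * m - 3} \<union> {1..6 * b}"
begin

text \<open>The rotation \<open>(r + 2) mod 3\<close> gives the top triples the diagonal symbols
  \<open>6 * i + 2\<close>, \<open>6 * i + 1\<close>, \<open>6 * i + 3\<close>, leaving the residues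
  4, 5, 0 modulo 6 to the \<open>block_row\<close> triples.\<close>

definition K :: "nat \<Rightarrow> nat \<Rightarrow> nat" where
  "K r c =
     (if r < 3 * m then 3 * (r div 3) + (r + 2) mod 3
      else if r < 3 * m + g then 3 * m + S (r - 3 * m) ((c + n - 3 * m) mod n)
      else if r < 3 * m + g + 3 * b then
        let q = r - (3 * m + g); x = 3 * m + g + 3 * (q div 3)
        in x + block_row (q mod 3) ((c + n - x) mod n)
      else 3 * m + g + 3 * b + R (r - (3 * m + g + 3 * b)))"

lemma middle_row:
  assumes "3 * m + g \<le> r" "r < 3 * m + g + 3 * b"
  obtains i j where "i < b" "j < 3" "r = 3 * m + g + 3 * i + j"
proof -
  define q where "q = r - (3 * m + g)"
  have "r = 3 * m + g + q" "q < 3 * b" using assms by (auto simp: q_def)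
  thus ?thesis by (intro that[of "q div 3" "q mod 3"]) auto
qed

lemma row_cases:
  assumes "r < n"
  obtains (N) i j where "i < m" "j < 3" "r = 3 * i + j"
  | (S) j where "j < g" "r = 3 * m + j"
  | (B) i j where "i < b" "j < 3" "r = 3 * m + g + 3 * i + j"
  | (R) j where "j < h" "r = 3 * m + g + 3 * b + j"
proof -
  consider "r < 3 * m" | "3 * m \<le> r" "r < 3 * m + g"
    | "3 * m + g \<le> r" "r < 3 * m + g + 3 * b" | "3 * m + g + 3 * b \<le> r"
    by linarith
  thus thesis
  proof cases
    case 1
    thus ?thesis by (intro N[of "r div 3" "r mod 3"]) auto
  next
    case 2
    thus ?thesis by (intro S[of "r - 3 * m"]) auto
  next
    case 3
    thus ?thesis by (rule middle_row) (rule B)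
  next
    case 4
    thus ?thesis using assms unfolding n_eq by (intro R[of "r - (3 * m + g + 3 * b)"]) auto
  qed
qed

lemma K_N:
  assumes "i < m" "j < 3"
  shows "K (3 * i + j) c = 3 * i + (j + 2) mod 3"
proof -
  have "(3 * i + j) div 3 = i" "(3 * i + j + 2) mod 3 = (j + 2) mod 3" "3 * i + j < 3 * m"
    using assms by presburger+
  thus ?thesis by (simp add: K_def)
qed

lemma K_S: "j < g \<Longrightarrow> K (3 * m + j) c = 3 * m + S j ((c + n - 3 * m) mod n)"
  by (simp add: K_def)

lemma K_B:
  assumes "i < b" "j < 3"
  shows "K (3 * m + g + 3 * i + j) c =
    3 * m + g + 3 * i + block_row j ((c + n - (3 * m + g + 3 * i)) mod n)"
proof -
  have "3 * m + g + 3 * i + j - (3 * m + g) = 3 * i + j" "(3 * i + j) div 3 = i"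
    "(3 * i + j) mod 3 = j" "\<not> 3 * m + g + 3 * i + j < 3 * m" "\<not> 3 * m + g + 3 * i + j < 3 * m + g"
    "3 * m + g + 3 * i + j < 3 * m + g + 3 * b"
    using assms by presburger+
  thus ?thesis unfolding K_def Let_def by (simp only: if_False if_True)
qed

lemma K_R: "j < h \<Longrightarrow> K (3 * m + g + 3 * b + j) c = 3 * m + g + 3 * b + R j"
  by (simp add: K_def)

lemma n_pos: "n > 0"
  using n_ge by simp

lemma K_N_bounds: "i < m \<Longrightarrow> j < 3 \<Longrightarrow> K (3 * i + j) c < 3 * i + 3"
  by (simp add: K_N)

lemma K_S_bounds:
  assumes "j < g"
  shows "3 * m \<le> K (3 * m + j) c" and "K (3 * m + j) c < 3 * m + g"
proof -
  have "S j ((c + n - 3 * m) mod n) < g" by (rule S_less[OF assms]) (use n_pos in simp)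
  thus "3 * m \<le> K (3 * m + j) c" "K (3 * m + j) c < 3 * m + g"
    unfolding K_S[OF assms] by linarith+
qed

lemma K_B_bounds:
  assumes "i < b" "j < 3"
  shows "3 * m + g + 3 * i \<le> K (3 * m + g + 3 * i + j) c"
    and "K (3 * m + g + 3 * i + j) c < 3 * m + g + 3 * i + 3"
  using block_row_less[of j "(c + n - (3 * m + g + 3 * i)) mod n"]
  unfolding K_B[OF assms] by linarith+

lemma K_R_bounds:
  assumes "j < h"
  shows "3 * m + g + 3 * b \<le> K (3 * m + g + 3 * b + j) c"
    and "K (3 * m + g + 3 * b + j) c < n"
  using R_less[OF assms] n_eq unfolding K_R[OF assms] by linarith+

lemma K_less:
  assumes "r < n"
  shows "K r c < n"
  using assms
proof (cases rule: row_cases)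
  case (N i j)
  thus ?thesis using K_N_bounds[of i j c] n_eq by simp
next
  case (S j)
  thus ?thesis using K_S_bounds(2)[of j c] n_eq by simp
next
  case (B i j)
  thus ?thesis using K_B_bounds(2)[of i j c] n_eq by simp
next
  case (R j)
  thus ?thesis using K_R_bounds(2)[of j c] by simp
qed

text \<open>Each group of rows takes its values in its own range, so rows that agree in a column lie
  in the same group.\<close>

lemma K_region:
  assumes "r < n"
  shows "K r c < 3 * m \<longleftrightarrow> r < 3 * m"
    and "K r c < 3 * m + g \<longleftrightarrow> r < 3 * m + g"
    and "K r c < 3 * m + g + 3 * b \<longleftrightarrow> r < 3 * m + g + 3 * b"
proof -
  have "(K r c < 3 * m \<longleftrightarrow> r < 3 * m) \<and> (K r c < 3 * m + g \<longleftrightarrow> r < 3 * m + g) \<and>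
    (K r c < 3 * m + g + 3 * b \<longleftrightarrow> r < 3 * m + g + 3 * b)"
    using assms
  proof (cases rule: row_cases)
    case (N i j)
    thus ?thesis using K_N_bounds[of i j c] by auto
  next
    case (S j)
    thus ?thesis using K_S_bounds[of j c] by auto
  next
    case (B i j)
    thus ?thesis using K_B_bounds[of i j c] by auto
  next
    case (R j)
    thus ?thesis using K_R_bounds(1)[of j c] by auto
  qed
  thus "K r c < 3 * m \<longleftrightarrow> r < 3 * m" "K r c < 3 * m + g \<longleftrightarrow> r < 3 * m + g"
    "K r c < 3 * m + g + 3 * b \<longleftrightarrow> r < 3 * m + g + 3 * b" by blast+
qed

lemma K_col: "inj_on (\<lambda>r. K r c) {..<n}"
proof (rule inj_onI)
  fix r q assume r: "r \<in> {..<n}" and q: "q \<in> {..<n}" and eq: "K r c = K q c"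
  have "r < n" "q < n" using r q by auto
  have region: "r < 3 * m \<longleftrightarrow> q < 3 * m" "r < 3 * m + g \<longleftrightarrow> q < 3 * m + g"
    "r < 3 * m + g + 3 * b \<longleftrightarrow> q < 3 * m + g + 3 * b"
    using K_region[OF \<open>r < n\<close>, of c] K_region[OF \<open>q < n\<close>, of c] eq by auto
  let ?t = "\<lambda>x. (c + n - x) mod n"
  have t: "?t x < n" for x using n_pos by simp
  show "r = q" using \<open>r < n\<close>
  proof (cases rule: row_cases)
    case (N i j)
    with \<open>q < n\<close> region obtain i' j' where N': "i' < m" "j' < 3" "q = 3 * i' + j'"
      by (cases rule: row_cases) auto
    have e: "3 * i + (j + 2) mod 3 = 3 * i' + (j' + 2) mod 3"
      using eq unfolding N(3) N'(3) K_N[OF N(1,2)] K_N[OF N'(1,2)] .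
    \<comment> \<open>Triple \<open>i\<close> only takes the three values from \<open>3 * i\<close>
      on, so a value determines its triple.\<close>
    hence "i = i'"
      using mod_less_divisor[of 3 "j + 2"] mod_less_divisor[of 3 "j' + 2"] by linarith
    with e have "(j + 2) mod 3 = (j' + 2) mod 3" by simp
    with N(2) N'(2) have "j = j'" by presburger
    with \<open>i = i'\<close> show ?thesis using N N' by simp
  next
    case (S j)
    with \<open>q < n\<close> region obtain j' where S': "j' < g" "q = 3 * m + j'"
      by (cases rule: row_cases) auto
    have "S j (?t (3 * m)) = S j' (?t (3 * m))"
      using eq unfolding S(2) S'(2) K_S[OF S(1)] K_S[OF S'(1)] by simp
    hence "j = j'" by (rule inj_onD[OF S_col[OF t]]) (use S S' in simp_all)
    thus ?thesis using S S' by simp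
  next
    case (B i j)
    have "3 * m + g \<le> q" "q < 3 * m + g + 3 * b" using B region by linarith+
    then obtain i' j' where B': "i' < b" "j' < 3" "q = 3 * m + g + 3 * i' + j'"
      by (rule middle_row)
    have e: "3 * i + block_row j (?t (3 * m + g + 3 * i))
        = 3 * i' + block_row j' (?t (3 * m + g + 3 * i'))"
      using eq unfolding B(3) B'(3) K_B[OF B(1,2)] K_B[OF B'(1,2)] by linarith
    hence "i = i'"
      using block_row_less[of j "?t (3 * m + g + 3 * i)"]
        block_row_less[of j' "?t (3 * m + g + 3 * i')"] by linarith
    with e have "block_row j (?t (3 * m + g + 3 * i)) = block_row j' (?t (3 * m + g + 3 * i))"
      by simp
    hence "j = j'" by (rule inj_onD[OF inj_on_block_row]) (use B B' in simp_all)
    with \<open>i = i'\<close> show ?thesis using B B' by simp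
  next
    case (R j)
    have "3 * m + g + 3 * b \<le> q" using R region by linarith
    then obtain j' where R': "j' < h" "q = 3 * m + g + 3 * b + j'"
      using \<open>q < n\<close> n_eq le_Suc_ex by (metis nat_add_left_cancel_less)
    have "R j = R j'"
      using eq unfolding R(2) R'(2) K_R[OF R(1)] K_R[OF R'(1)] by simp
    hence "j = j'" by (rule inj_onD[OF R_inj]) (use R R' in simp_all)
    thus ?thesis using R R' by simp
  qed
qed

lemma K_row:
  assumes "r < n"
  shows "inj_on (\<lambda>c. (K r c + c) mod n) {..<n}"
  using assms
proof (cases rule: row_cases)
  case (N i j)
  have "inj_on (\<lambda>c. (c + (3 * i + (j + 2) mod 3)) mod n) {..<n}"
    by (rule inj_on_mod_shift) auto
  thus ?thesis unfolding N(3) K_N[OF N(1,2)] by (simp only: add.commute)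
next
  case (S j)
  thus ?thesis unfolding S(2) K_S[OF S(1)]
    using inj_on_row_shift[OF S_row[of j], of "3 * m"] n_eq by simp
next
  case (B i j)
  thus ?thesis unfolding B(3) K_B[OF B(1,2)]
    using inj_on_row_shift[OF inj_on_block_row_shift[of n j], of "3 * m + g + 3 * i"] n_eq n_even n_ge
    by simp
next
  case (R j)
  have "inj_on (\<lambda>c. (c + (3 * m + g + 3 * b + R j)) mod n) {..<n}"
    by (rule inj_on_mod_shift) auto
  thus ?thesis unfolding R(2) K_R[OF R(1)] by (simp only: add.commute)
qed

lemma latin_square_K: "latin_square n (shift_square n K)"
  by (intro latin_shift_square K_less K_col K_row)

section \<open>Distinctness of the diagonal symbols\<close>

definition diag_sym :: "nat \<Rightarrow> nat" where
  "diag_sym r = (K r r + r) mod n"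

lemma diag_sym_N:
  assumes "i < m" "j < 3"
  shows "diag_sym (3 * i + j) = 6 * i + (j + 2) mod 3 + j"
proof -
  have "(j + 2) mod 3 + j \<le> 3" using assms(2) by presburger
  hence "6 * i + (j + 2) mod 3 + j < n" using assms balance by linarith
  moreover have "K (3 * i + j) (3 * i + j) + (3 * i + j) = 6 * i + (j + 2) mod 3 + j"
    unfolding K_N[OF assms] by linarith
  ultimately show ?thesis unfolding diag_sym_def by simp
qed

lemma diag_offset: "x \<le> n \<Longrightarrow> j < n \<Longrightarrow> (x + j + n - x) mod n = j"
  by simp

lemma diag_sym_S:
  assumes "j < g"
  shows "diag_sym (3 * m + j) = v j"
proof -
  have "(3 * m + j + n - 3 * m) mod n = j" using assms n_eq by (intro diag_offset) auto
  hence "K (3 * m + j) (3 * m + j) + (3 * m + j) = 6 * m + S j j + j"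
    unfolding K_S[OF assms] by simp
  hence "diag_sym (3 * m + j) = (6 * m + S j j + j) mod n" unfolding diag_sym_def by (simp only:)
  thus ?thesis using sym_S[OF assms] v_less[of j] assms by auto
qed

lemma block_row_diag: "j < 3 \<Longrightarrow> block_row j j = 2"
  by (auto simp: block_row_def numeral_3_eq_3 less_Suc_eq)

lemma K_B_diag:
  assumes "i < b" "j < 3"
  shows "K (3 * m + g + 3 * i + j) (3 * m + g + 3 * i + j) = 3 * m + g + 3 * i + 2"
proof -
  have "(3 * m + g + 3 * i + j + n - (3 * m + g + 3 * i)) mod n = j"
    using assms n_eq n_ge by (intro diag_offset) auto
  thus ?thesis unfolding K_B[OF assms] using block_row_diag[OF assms(2)] by simp
qed

text \<open>The sum passes \<open>n\<close> exactly once: \<open>balance\<close> turns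
  \<open>6 * m + 2 * g + 2\<close> into \<open>n + 4\<close>, and \<open>small\<close> keeps
  \<open>6 * i + 4 + j \<le> 6 * b\<close> below \<open>n\<close>.\<close>

lemma diag_sym_B:
  assumes "i < b" "j < 3"
  shows "diag_sym (3 * m + g + 3 * i + j) = 6 * i + 4 + j"
proof -
  have "6 * i + 4 + j < n" using assms small by linarith
  moreover have "K (3 * m + g + 3 * i + j) (3 * m + g + 3 * i + j) + (3 * m + g + 3 * i + j)
      = n + (6 * i + 4 + j)"
    unfolding K_B_diag[OF assms] using balance by linarith
  ultimately show ?thesis unfolding diag_sym_def by (simp only: mod_add_self1 mod_less)
qed

lemma diag_sym_R:
  assumes "j < h"
  shows "diag_sym (3 * m + g + 3 * b + j) = v (g + j)"
proof -
  have "K (3 * m + g + 3 * b + j) (3 * m + g + 3 * b + j) + (3 * m + g + 3 * b + j)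
      = n + v (g + j)"
    unfolding K_R[OF assms] using sym_R[OF assms] by (simp add: algebra_simps)
  thus ?thesis using v_less[of "g + j"] assms unfolding diag_sym_def by simp
qed

text \<open>The diagonal symbols of the two periodic parts of the layout are told apart modulo 6;
  those of the two remaining parts avoid the ranges of both.\<close>

lemma diag_cases:
  assumes "r < n"
  obtains (N) i j where "r = 3 * i + j" "j < 3" "diag_sym r = 6 * i + (j + 2) mod 3 + j"
      "diag_sym r \<in> {1..6 * m - 3}" "diag_sym r mod 6 \<in> {1, 2, 3}"
  | (B) i j where "r = 3 * m + g + 3 * i + j" "j < 3" "diag_sym r = 6 * i + 4 + j"
      "diag_sym r \<in> {1..6 * b}" "diag_sym r mod 6 \<in> {4, 5, 0}"
  | (rest) j where "j < g + h" "r = (if j < g then 3 * m + j else 3 * m + g + 3 * b + (j - g))"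
      "diag_sym r = v j"
      "diag_sym r \<notin> {1..6 * m - 3} \<union> {1..6 * b}"
  using assms
proof (cases rule: row_cases)
  case (N i j)
  define a where "a = (j + 2) mod 3 + j"
  have "j = 0 \<or> j = 1 \<or> j = 2" using N(2) by linarith
  hence a: "a = 1 \<or> a = 2 \<or> a = 3" by (auto simp: a_def)
  have sym: "diag_sym r = 6 * i + a" using diag_sym_N[OF N(1,2)] by (simp add: N(3) a_def)
  show ?thesis
  proof (rule that(1))
    show "r = 3 * i + j" "j < 3" by fact+
    show "diag_sym r = 6 * i + (j + 2) mod 3 + j" using sym by (simp add: a_def)
    show "diag_sym r \<in> {1..6 * m - 3}" using sym a N(1) by auto
    show "diag_sym r mod 6 \<in> {1, 2, 3}" using sym a by auto
  qed
next
  case (S j)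
  show ?thesis
    by (rule that(3)[of j]) (use S diag_sym_S[of j] v_avoid[of j] in simp_all)
next
  case (B i j)
  have sym: "diag_sym r = 6 * i + 4 + j" using diag_sym_B[OF B(1,2)] by (simp add: B(3))
  show ?thesis
  proof (rule that(2))
    show "r = 3 * m + g + 3 * i + j" "j < 3" by fact+
    show "diag_sym r = 6 * i + 4 + j" by fact
    show "diag_sym r \<in> {1..6 * b}" using sym B(1,2) by simp
    have "(6 * i + 4 + j) mod 6 = 4 \<or> (6 * i + 4 + j) mod 6 = 5 \<or> (6 * i + 4 + j) mod 6 = 0"
      using B(2) by presburger
    thus "diag_sym r mod 6 \<in> {4, 5, 0}" unfolding sym by blast
  qed
next
  case (R j)
  show ?thesis
    by (rule that(3)[of "g + j"]) (use R diag_sym_R[of j] v_avoid[of "g + j"] in simp_all)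
qed

text \<open>This makes the diagonal a transversal. Inside a periodic part the triple index enters
  with factor 6 while the offset varies by less than 6, so both can be recovered from the
  symbol.\<close>

lemma inj_on_diag_sym: "inj_on diag_sym {..<n}"
proof (rule inj_onI)
  fix r q assume "r \<in> {..<n}" "q \<in> {..<n}" and eq: "diag_sym r = diag_sym q"
  hence "r < n" "q < n" by auto
  show "r = q" using \<open>r < n\<close>
  proof (cases rule: diag_cases)
    case (N i j)
    note r = this
    show ?thesis using \<open>q < n\<close>
    proof (cases rule: diag_cases)
      case (N i' j')
      have e: "6 * i + ((j + 2) mod 3 + j) = 6 * i' + ((j' + 2) mod 3 + j')" using r(3) N(3) eq by linarith
      moreover have "(j + 2) mod 3 + j < 6" "(j' + 2) mod 3 + j' < 6" using r(2) N(2) by presburger+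
      ultimately have "i = i'" by linarith
      with e have "(j + 2) mod 3 + j = (j' + 2) mod 3 + j'" by simp
      \<comment> \<open>The offsets for \<open>j\<close> equal to 0, 1, 2 are 2, 1, 3.\<close>
      moreover have "j = 0 \<or> j = 1 \<or> j = 2" "j' = 0 \<or> j' = 1 \<or> j' = 2"
        using r(2) N(2) by linarith+
      ultimately have "j = j'" by auto
      with \<open>i = i'\<close> show ?thesis using r(1) N(1) by simp
    next
      case B
      thus ?thesis using r(5) eq by auto
    next
      case rest
      thus ?thesis using r(4) eq by auto
    qed
  next
    case (B i j)
    note r = this
    show ?thesis using \<open>q < n\<close>
    proof (cases rule: diag_cases)
      case (B i' j')
      have e: "6 * i + j = 6 * i' + j'" using r(3) B(3) eq by linarith
      with r(2) B(2) have "i = i'" by linarith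
      with e show ?thesis using r(1) B(1) by simp
    next
      case N
      thus ?thesis using r(5) eq by auto
    next
      case rest
      thus ?thesis using r(4) eq by auto
    qed
  next
    case (rest j)
    note r = this
    show ?thesis using \<open>q < n\<close>
    proof (cases rule: diag_cases)
      case (rest j')
      have "j = j'" by (rule inj_onD[OF v_inj]) (use r(1,3) rest(1,3) eq in simp_all)
      thus ?thesis using r(2) rest(2) by simp
    next
      case N
      thus ?thesis using r(4) eq by auto
    next
      case B
      thus ?thesis using r(4) eq by auto
    qed
  qed
qed

section \<open>Spreads, unique maxima and the count of pinned entries\<close>

text \<open>This is the weight fed to \<open>pinned_diagonal\<close>; the 2 is the diagonal value of
  \<open>block_row\<close>, whose least value is 0.\<close>

definition spread :: "nat \<Rightarrow> nat" where
  "spread r = (if r < 3 * m then 0 else if r < 3 * m + g then w (r - 3 * m)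
     else if r < 3 * m + g + 3 * b then 2 else 0)"

lemma sum_spread: "(\<Sum>r<n. spread r) = 6 * b + (\<Sum>j<g. w j)"
proof -
  have split: "(\<Sum>r<p + q. f r) = (\<Sum>r<p. f r) + (\<Sum>r<q. f (p + r))" for p q and f :: "nat \<Rightarrow> nat"
    by (induction q) auto
  show ?thesis unfolding n_eq by (simp add: split spread_def)
qed

lemma K_max:
  assumes "r < n" "c < n"
  shows "K r c \<le> K r r \<and> K r r \<le> K r c + spread r"
  using assms(1)
proof (cases rule: row_cases)
  case (N i j)
  show ?thesis unfolding N(3) K_N[OF N(1,2)] by simp
next
  case (S j)
  have "(3 * m + j + n - 3 * m) mod n = j" using S n_eq by (intro diag_offset) auto
  moreover have "(c + n - 3 * m) mod n < n" using n_pos by simp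
  ultimately show ?thesis unfolding S(2) K_S[OF S(1)]
    using S_le[OF S(1)] S_spread[OF S(1)] S(1) by (simp add: spread_def)
next
  case (B i j)
  let ?t = "(c + n - (3 * m + g + 3 * i)) mod n"
  have "spread r = 2" using B by (simp add: spread_def)
  thus ?thesis unfolding B(3) K_B_diag[OF B(1,2)] unfolding K_B[OF B(1,2)]
    using block_row_less[of j ?t] by auto
next
  case (R j)
  show ?thesis unfolding R(2) K_R[OF R(1)] by simp
qed

text \<open>A converse of \<open>diag_offset\<close>, by which a maximum unique in local columns is
  unique in the square.\<close>

lemma offset_eq:
  assumes "c < n" "x + j < n" "(c + n - x) mod n = j"
  shows "c = x + j"
proof (cases "c < x")
  case True
  thus ?thesis using assms by simp
next
  case False
  then obtain d where "c = x + d" by (auto simp: not_less le_iff_add)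
  thus ?thesis using assms by simp
qed

lemma pinned_row:
  assumes "r < n" "\<And>c. c < n \<Longrightarrow> c \<noteq> r \<Longrightarrow> K r c < K r r"
  shows "pinned n (shift_square n K) (r, r, diag_sym r)"
  unfolding diag_sym_def
proof (rule pinned_diagonal[of K n spread r])
  show "inj_on (\<lambda>r. (K r r + r) mod n) {..<n}"
    using inj_on_diag_sym unfolding diag_sym_def .
  show "sum spread {..<n} < n" unfolding sum_spread by (rule small)
qed (use assms K_max in blast)+

text \<open>Only the first row of a trade qualifies: in the other two the value 2 recurs off the
  diagonal.\<close>

lemma pinned_B:
  assumes "i < b"
  shows "pinned n (shift_square n K) (3 * m + g + 3 * i, 3 * m + g + 3 * i, 6 * i + 4)"
proof -
  let ?x = "3 * m + g + 3 * i"
  have x: "?x < n" using assms n_eq by linarith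
  have "pinned n (shift_square n K) (?x, ?x, diag_sym ?x)"
  proof (rule pinned_row[OF x])
    fix c assume c: "c < n" "c \<noteq> ?x"
    hence "(c + n - ?x) mod n \<noteq> 0" using offset_eq[of c ?x 0] x by auto
    thus "K ?x c < K ?x ?x"
      using K_B[OF assms, of 0 c] K_B_diag[OF assms, of 0] by (simp add: block_row_def)
  qed
  thus ?thesis using diag_sym_B[OF assms, of 0] by simp
qed

lemma pinned_S:
  assumes "j < g" and strict: "\<And>t. t < n \<Longrightarrow> t \<noteq> j \<Longrightarrow> S j t < S j j"
  shows "pinned n (shift_square n K) (3 * m + j, 3 * m + j, diag_sym (3 * m + j))"
proof (rule pinned_row)
  show r: "3 * m + j < n" using assms n_eq by linarith
  fix c assume c: "c < n" "c \<noteq> 3 * m + j"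
  hence "(c + n - 3 * m) mod n \<noteq> j" using offset_eq[of c "3 * m" j] r by auto
  moreover have "(3 * m + j + n - 3 * m) mod n = j" using r by (intro diag_offset) auto
  ultimately show "K (3 * m + j) c < K (3 * m + j) (3 * m + j)"
    unfolding K_S[OF assms(1)] using strict n_pos by simp
qed

text \<open>Entries are counted through their rows: those from \<open>J\<close> lie before row
  \<open>3 * m + g\<close> and those from trades do not, so none is counted twice.\<close>

lemma card_pinned:
  assumes J: "J \<subseteq> {..<g}"
    and strict: "\<And>j t. j \<in> J \<Longrightarrow> t < n \<Longrightarrow> t \<noteq> j \<Longrightarrow> S j t < S j j"
  shows "b + card J \<le> card {e. pinned n (shift_square n K) e}"
proof -
  let ?P = "{e. pinned n (shift_square n K) e}"
  let ?A = "(\<lambda>i. 3 * m + g + 3 * i) ` {..<b}" and ?B = "(\<lambda>j. 3 * m + j) ` J"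
  have "finite J" using J finite_subset by blast
  \<comment> \<open>Finiteness matters: \<open>card\<close> of an infinite set is 0, which would
    spoil the lower bound.\<close>
  have "?P \<subseteq> {..<n} \<times> {..<n} \<times> {..<n}" by (auto simp: pinned_def shift_square_def)
  hence fin: "finite ?P" by (rule finite_subset) auto
  have "?A \<inter> ?B = {}" using J by fastforce
  hence "card (?A \<union> ?B) = b + card J"
    using \<open>finite J\<close> by (simp add: card_Un_disjoint card_image inj_on_def)
  moreover have "?A \<union> ?B \<subseteq> fst ` ?P"
  proof -
    have fst_mem: "r \<in> fst ` ?P" if "pinned n (shift_square n K) (r, c, s)" for r c s
      using that by force
    have "3 * m + g + 3 * i \<in> fst ` ?P" if "i < b" for i
      by (rule fst_mem[OF pinned_B[OF that]])
    moreover have "3 * m + j \<in> fst ` ?P" if "j \<in> J" for j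
    proof -
      have "pinned n (shift_square n K) (3 * m + j, 3 * m + j, diag_sym (3 * m + j))"
        by (rule pinned_S) (use that J strict in auto)
      thus ?thesis by (rule fst_mem)
    qed
    ultimately show ?thesis by blast
  qed
  ultimately show ?thesis
    using fin by (metis card_image_le card_mono finite_imageI le_trans)
qed

end

section \<open>The three exceptional groups of rows\<close>

text \<open>The three instances of the part \<open>S\<close>, for \<open>n\<close> congruent to 0, 2 and 4 modulo 6. Up to
  finitely many columns, two or four rows exchange their contents periodically: with period 2, 4
  (on the odd columns) and 3.\<close>

definition rows4 :: "nat \<Rightarrow> nat \<Rightarrow> nat" where
  "rows4 j t =
     (if j = 0 then if t = 0 then 3 else if t = 2 then 0 else if t = 3 then 1
        else if even t then 2 else 0
      else if j = 1 then if t = 0 then 2 else if t = 1 then 3 else if t = 2 then 1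
        else if t = 3 then 2 else if even t then 3 else 1
      else if j = 2 then if t = 1 then 1 else if t = 2 then 3 else if t = 3 then 0
        else if even t then 0 else 2
      else if t = 1 then 2 else if t = 2 then 2 else if even t then 1 else 3)"

definition rows5 :: "nat \<Rightarrow> nat \<Rightarrow> nat \<Rightarrow> nat" where
  "rows5 n j t =
     (if j = 0 then 3
      else if j = 1 then if t = 1 then 4 else if t = 2 \<or> t = 3 then 1 else 2
      else if j = 2 then if t = 2 then 2 else if t = 3 then 0 else 1
      else if j = 3 then if even t then 0 else if t = 1 then if n mod 4 = 2 then 2 else 0
        else if t mod 4 = 1 then 0 else 4
      else if even t then 4 else if t = 1 then if n mod 4 = 2 then 0 else 2
        else if t = 3 then 2 else if t mod 4 = 1 then 4 else 0)"

definition rows6 :: "nat \<Rightarrow> nat \<Rightarrow> nat" where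
  "rows6 j t =
     (if j = 0 then 4 else if j = 1 then 0 else if j = 2 then 1
      else if j = 3 then if t = 3 then 5 else if t = 4 \<or> t = 5 then 2 else 3
      else if j = 4 then if t = 1 then 2 else if t = 2 then 5 else if t = 3 then 3 else if t = 5 then 3
        else if t mod 3 = 2 then 2 else 5
      else if t = 1 then 5 else if t = 2 then 2 else if t = 4 then 3
        else if t mod 3 = 2 then 5 else 2)"

lemma less4_cases: "j < 4 \<Longrightarrow> j = 0 \<or> j = 1 \<or> j = 2 \<or> j = (3::nat)" by linarith
lemma less5_cases: "j < 5 \<Longrightarrow> j = 0 \<or> j = 1 \<or> j = 2 \<or> j = 3 \<or> j = (4::nat)" by linarith
lemma less6_cases: "j < 6 \<Longrightarrow> j = 0 \<or> j = 1 \<or> j = 2 \<or> j = 3 \<or> j = 4 \<or> j = (5::nat)" by linarith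

lemma inj_on_rows4: "inj_on (\<lambda>j. rows4 j t) {..<4}"
proof (rule inj_onI)
  fix i j :: nat assume "i \<in> {..<4}" "j \<in> {..<4}" and eq: "rows4 i t = rows4 j t"
  hence "i = 0 \<or> i = 1 \<or> i = 2 \<or> i = 3" "j = 0 \<or> j = 1 \<or> j = 2 \<or> j = 3"
    using less4_cases by auto
  \<comment> \<open>The six patterns belong to columns 0, 1, 2, 3 and to the even and odd columns
    from 4 on.\<close>
  moreover have "(rows4 0 t, rows4 1 t, rows4 2 t, rows4 3 t) \<in>
      {(3, 2, 0, 1), (0, 3, 1, 2), (0, 1, 3, 2), (1, 2, 0, 3), (2, 3, 0, 1), (0, 1, 2, 3)}"
    by (simp add: rows4_def)
  ultimately show "i = j" using eq by (elim disjE) auto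
qed

lemma inj_on_rows5: "inj_on (\<lambda>j. rows5 n j t) {..<5}"
proof (rule inj_onI)
  fix i j :: nat assume "i \<in> {..<5}" "j \<in> {..<5}" and eq: "rows5 n i t = rows5 n j t"
  hence "i = 0 \<or> i = 1 \<or> i = 2 \<or> i = 3 \<or> i = 4" "j = 0 \<or> j = 1 \<or> j = 2 \<or> j = 3 \<or> j = 4"
    using less5_cases by auto
  thus "i = j" using eq by (elim disjE) (simp_all add: rows5_def split: if_splits)
qed

lemma inj_on_rows6: "inj_on (\<lambda>j. rows6 j t) {..<6}"
proof (rule inj_onI)
  fix i j :: nat assume "i \<in> {..<6}" "j \<in> {..<6}" and eq: "rows6 i t = rows6 j t"
  hence "i = 0 \<or> i = 1 \<or> i = 2 \<or> i = 3 \<or> i = 4 \<or> i = 5"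
    "j = 0 \<or> j = 1 \<or> j = 2 \<or> j = 3 \<or> j = 4 \<or> j = 5"
    using less6_cases by auto
  thus "i = j" using eq by (elim disjE) (simp_all add: rows6_def split: if_splits)
qed

lemma mod4_cases: obtains q where "t = 4 * q \<or> t = 4 * q + 1 \<or> t = 4 * q + 2 \<or> t = 4 * q + (3::nat)"
proof (rule that[of "t div 4"])
  have "t mod 4 < 4" by simp
  thus "t = 4 * (t div 4) \<or> t = 4 * (t div 4) + 1 \<or> t = 4 * (t div 4) + 2 \<or> t = 4 * (t div 4) + 3"
    using mult_div_mod_eq[of 4 t] by linarith
qed
lemma mod3_cases: obtains q where "t = 3 * q \<or> t = 3 * q + 1 \<or> t = 3 * q + (2::nat)"
proof (rule that[of "t div 3"])
  have "t mod 3 < 3" by simp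
  thus "t = 3 * (t div 3) \<or> t = 3 * (t div 3) + 1 \<or> t = 3 * (t div 3) + 2"
    using mult_div_mod_eq[of 3 t] by linarith
qed

lemma inj_on_rows4_shift:
  assumes "even n" "n \<ge> 10" "j < 4"
  shows "inj_on (\<lambda>t. (rows4 j t + t) mod n) {..<n}"
proof (rule inj_on_mod_if_no_wrap)
  fix t u assume "t < n" "u < n"
  show "rows4 j t + t < n + n" using \<open>t < n\<close> assms(2) by (simp add: rows4_def)
  note j = less4_cases[OF assms(3)]
  show "t = u" if "rows4 j t + t = rows4 j u + u"
    using j that by (elim disjE) (simp_all add: rows4_def split: if_splits; presburger)+
  show "rows4 j t + t \<noteq> rows4 j u + u + n"
    using j \<open>t < n\<close> \<open>u < n\<close> assms(1,2)
    by (elim disjE) (simp_all add: rows4_def split: if_splits; presburger)+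
qed

text \<open>In rows 3 and 4 one odd residue class modulo 4 is moved by 4, up to small columns. Its
  last column wraps around to symbol 1 or 3 depending on \<open>n mod 4\<close>; column 1 takes the
  other one, hence the parameter \<open>n\<close> of \<open>rows5\<close>.\<close>

lemma inj_on_rows5_shift:
  assumes "even n" "n \<ge> 10" "j < 5"
  shows "inj_on (\<lambda>t. (rows5 n j t + t) mod n) {..<n}"
proof (rule inj_on_mod_if_no_wrap)
  fix t u assume "t < n" "u < n"
  show "rows5 n j t + t < n + n" using \<open>t < n\<close> assms(2) by (simp add: rows5_def)
  note j = less5_cases[OF assms(3)]
  obtain q where q: "t = 4 * q \<or> t = 4 * q + 1 \<or> t = 4 * q + 2 \<or> t = 4 * q + 3"
    by (rule mod4_cases)
  show "t = u" if "rows5 n j t + t = rows5 n j u + u"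
  proof -
    obtain p where p: "u = 4 * p \<or> u = 4 * p + 1 \<or> u = 4 * p + 2 \<or> u = 4 * p + 3"
      by (rule mod4_cases)
    consider "j < 3" | "j = 3 \<or> j = 4" using j by linarith
    thus ?thesis
    proof cases
      case 1
      hence "j = 0 \<or> j = 1 \<or> j = 2" by linarith
      thus ?thesis using that by (elim disjE) (simp_all add: rows5_def split: if_splits)
    next
      case 2
      thus ?thesis using q p that
        by (elim disjE, simp_all add: rows5_def, auto split: if_splits, presburger+)
    qed
  qed
  show "rows5 n j t + t \<noteq> rows5 n j u + u + n"
  proof
    assume eq: "rows5 n j t + t = rows5 n j u + u + n"
    have "rows5 n j t \<le> 4" by (simp add: rows5_def)
    \<comment> \<open>A value of at most 4 leads past \<open>n\<close> only from the last four
      columns, which lie beyond the irregular ones.\<close>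
    hence "u < 4" "6 \<le> t" using eq \<open>t < n\<close> assms(2) by linarith+
    have "n mod 4 = 0 \<or> n mod 4 = 2" using assms(1) by presburger
    then obtain p where "n = 4 * p \<or> n = 4 * p + 2" by (metis mult_div_mod_eq add_0_right)
    with j less4_cases[OF \<open>u < 4\<close>] q show False
      using eq \<open>6 \<le> t\<close> \<open>t < n\<close> 
      by (elim disjE, simp_all add: rows5_def split: if_splits, presburger+)
  qed
qed

text \<open>The last rows have period 3 up to small columns; \<open>n mod 3 = 1\<close> fixes the
  phase at which they wrap around, so that the final columns supply exactly the symbols missed by
  the irregular start.\<close>

lemma inj_on_rows6_shift:
  assumes "n mod 3 = 1" "n \<ge> 10" "j < 6"
  shows "inj_on (\<lambda>t. (rows6 j t + t) mod n) {..<n}"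
proof (rule inj_on_mod_if_no_wrap)
  fix t u assume "t < n" "u < n"
  show "rows6 j t + t < n + n" using \<open>t < n\<close> assms(2) by (simp add: rows6_def)
  note j = less6_cases[OF assms(3)]
  obtain q where q: "t = 3 * q \<or> t = 3 * q + 1 \<or> t = 3 * q + 2" by (rule mod3_cases)
  show "t = u" if "rows6 j t + t = rows6 j u + u"
  proof -
    obtain p where p: "u = 3 * p \<or> u = 3 * p + 1 \<or> u = 3 * p + 2" by (rule mod3_cases)
    consider "j < 3" | "j = 3 \<or> j = 4 \<or> j = 5" using j by linarith
    thus ?thesis
    proof cases
      case 1
      hence "j = 0 \<or> j = 1 \<or> j = 2" by linarith
      thus ?thesis using that by (elim disjE) (simp_all add: rows6_def)
    next
      case 2
      thus ?thesis using q p that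
        by (elim disjE; simp add: rows6_def) (auto split: if_splits; presburger)+
    qed
  qed
  show "rows6 j t + t \<noteq> rows6 j u + u + n"
  proof
    assume eq: "rows6 j t + t = rows6 j u + u + n"
    have "rows6 j t \<le> 5" by (simp add: rows6_def)
    hence "u < 5" "5 \<le> t" using eq \<open>t < n\<close> assms(2) by linarith+
    obtain p where "n = 3 * p + 1" using assms(1) by (metis mult_div_mod_eq)
    with j less5_cases[OF \<open>u < 5\<close>] q show False
      using eq \<open>5 \<le> t\<close> \<open>t < n\<close> 
      by (elim disjE; simp add: rows6_def split: if_splits; presburger)
  qed
qed

section \<open>Squares for the three even residues modulo 6\<close>

lemma latin_square_pinned4:
  "\<exists>L. latin_square (6 * b + 12) L \<and> b + 2 \<le> card {e. pinned (6 * b + 12) L e}"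
proof -
  \<comment> \<open>The triples occupy the symbols 1 to \<open>6 * b + 3\<close>, so
    \<open>?v\<close> lists 0 and \<open>6 * b + 4\<close> to \<open>6 * b + 11\<close>: first the
    diagonal of \<open>rows4\<close>, then the symbols that the order \<open>[2, 4, 1, 3, 0]\<close>
    of the last rows is chosen to supply.\<close>
  let ?v = "\<lambda>j. [6 * b + 9, 6 * b + 10, 6 * b + 11, 0,
    6 * b + 4, 6 * b + 7, 6 * b + 5, 6 * b + 8, 6 * b + 6] ! j"
  interpret layout "6 * b + 12" "b + 1" 4 b 5 rows4 "\<lambda>j. [2, 4, 1, 3, 0] ! j" ?v
    "\<lambda>j. [3, 2, 3, 2] ! j"
  proof
    show "inj_on (\<lambda>j. rows4 j t) {..<4}" for t by (rule inj_on_rows4)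
    show "inj_on (\<lambda>t. (rows4 j t + t) mod (6 * b + 12)) {..<6 * b + 12}" if "j < 4" for j
      by (rule inj_on_rows4_shift) (use that in simp_all)
    show "inj_on (\<lambda>j. [2, 4, 1, 3, 0 :: nat] ! j) {..<5}" by (rule inj_on_nth) auto
    show "inj_on ?v {..<4 + 5}" by (rule inj_on_nth) auto
    show "6 * b + (\<Sum>j<4. [3, 2, 3, 2] ! j) < 6 * b + 12" by (simp add: eval_nat_numeral)
  next
    fix j t :: nat assume "j < 4"
    hence j: "j = 0 \<or> j = 1 \<or> j = 2 \<or> j = 3" by linarith
    show "rows4 j t < 4" "rows4 j t \<le> rows4 j j" "rows4 j j \<le> rows4 j t + [3, 2, 3, 2] ! j"
      using j by (elim disjE; simp add: rows4_def)+
    show "6 * (b + 1) + rows4 j j + j = ?v j \<or> 6 * (b + 1) + rows4 j j + j = 6 * b + 12 + ?v j"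
      using j by (elim disjE) (simp_all add: rows4_def)
  next
    fix j :: nat assume "j < 5"
    hence "j = 0 \<or> j = 1 \<or> j = 2 \<or> j = 3 \<or> j = 4" by linarith
    thus "[2, 4, 1, 3, 0] ! j < (5::nat)"
      "2 * (3 * (b + 1) + 4 + 3 * b) + [2, 4, 1, 3, 0] ! j + j = 6 * b + 12 + ?v (4 + j)"
      by (elim disjE; simp)+
  next
    fix j :: nat assume "j < 4 + 5"
    hence "j = 0 \<or> j = 1 \<or> j = 2 \<or> j = 3 \<or> j = 4 \<or> j = 5 \<or> j = 6 \<or> j = 7 \<or> j = 8" by linarith
    thus "?v j < 6 * b + 12" "?v j \<notin> {1..6 * (b + 1) - 3} \<union> {1..6 * b}" by (elim disjE; simp)+
  qed simp_all
  \<comment> \<open>Rows 0 and 2 of \<open>rows4\<close> attain their maximum 3 only on the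
    diagonal.\<close>
  have "b + card {0, 2::nat} \<le> card {e. pinned (6 * b + 12) (shift_square (6 * b + 12) K) e}"
    by (rule card_pinned) (auto simp: rows4_def)
  thus ?thesis using latin_square_K by (auto simp: numeral_2_eq_2)
qed

text \<open>The group \<open>rows5\<close> has total spread 13, just below the available 14, and its
  rows 1 and 2 have unique maxima.\<close>

lemma latin_square_pinned5:
  "\<exists>L. latin_square (6 * b + 14) L \<and> b + 2 \<le> card {e. pinned (6 * b + 14) L e}"
proof -
  let ?n = "6 * b + 14"
  let ?v = "\<lambda>j. [6 * b + 9, 6 * b + 11, 6 * b + 10, 6 * b + 13, 0,
    6 * b + 5, 6 * b + 7, 6 * b + 4, 6 * b + 6, 6 * b + 8, 6 * b + 12] ! j"
  interpret layout ?n "b + 1" 5 b 6 "rows5 ?n" "\<lambda>j. [3, 4, 0, 1, 2, 5] ! j" ?v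
    "\<lambda>j. [0, 3, 2, 4, 4] ! j"
  proof
    show "inj_on (\<lambda>j. rows5 ?n j t) {..<5}" for t by (rule inj_on_rows5)
    show "inj_on (\<lambda>t. (rows5 ?n j t + t) mod ?n) {..<?n}" if "j < 5" for j
      by (rule inj_on_rows5_shift) (use that in simp_all)
    show "inj_on (\<lambda>j. [3, 4, 0, 1, 2, 5 :: nat] ! j) {..<6}" by (rule inj_on_nth) auto
    show "inj_on ?v {..<5 + 6}" by (rule inj_on_nth) auto
    show "6 * b + (\<Sum>j<5. [0, 3, 2, 4, 4] ! j) < ?n" by (simp add: eval_nat_numeral)
  next
    fix j t :: nat assume "j < 5"
    hence j: "j = 0 \<or> j = 1 \<or> j = 2 \<or> j = 3 \<or> j = 4" by linarith
    show "rows5 ?n j t < 5" "rows5 ?n j t \<le> rows5 ?n j j"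
      "rows5 ?n j j \<le> rows5 ?n j t + [0, 3, 2, 4, 4] ! j"
      using j by (elim disjE; simp add: rows5_def)+
    show "6 * (b + 1) + rows5 ?n j j + j = ?v j \<or> 6 * (b + 1) + rows5 ?n j j + j = ?n + ?v j"
      using j by (elim disjE) (simp_all add: rows5_def)
  next
    fix j :: nat assume "j < 6"
    hence "j = 0 \<or> j = 1 \<or> j = 2 \<or> j = 3 \<or> j = 4 \<or> j = 5" by linarith
    thus "[3, 4, 0, 1, 2, 5] ! j < (6::nat)"
      "2 * (3 * (b + 1) + 5 + 3 * b) + [3, 4, 0, 1, 2, 5] ! j + j = ?n + ?v (5 + j)"
      by (elim disjE; simp)+
  next
    fix j :: nat assume "j < 5 + 6"
    hence "j = 0 \<or> j = 1 \<or> j = 2 \<or> j = 3 \<or> j = 4 \<or> j = 5 \<or> j = 6 \<or> j = 7 \<or> j = 8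
      \<or> j = 9 \<or> j = 10" by presburger
    thus "?v j < ?n" "?v j \<notin> {1..6 * (b + 1) - 3} \<union> {1..6 * b}" by (elim disjE; simp)+
  qed simp_all
  have "b + card {1, 2::nat} \<le> card {e. pinned ?n (shift_square ?n K) e}"
    by (rule card_pinned) (auto simp: rows5_def)
  thus ?thesis using latin_square_K by (auto simp: numeral_2_eq_2)
qed

text \<open>With equally many triples of both kinds, these fill the symbols 1 to
  \<open>6 * b\<close>. The group \<open>rows6\<close> has total spread 9 against the available 10,
  and its row 3 gives the extra pinned entry.\<close>

lemma latin_square_pinned6:
  "\<exists>L. latin_square (6 * b + 10) L \<and> b + 1 \<le> card {e. pinned (6 * b + 10) L e}"
proof -
  let ?n = "6 * b + 10"
  let ?v = "\<lambda>j. [6 * b + 4, 6 * b + 1, 6 * b + 3, 6 * b + 8, 6 * b + 9, 0,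
    6 * b + 2, 6 * b + 6, 6 * b + 5, 6 * b + 7] ! j"
  interpret layout ?n b 6 b 4 rows6 "\<lambda>j. [0, 3, 1, 2] ! j" ?v
    "\<lambda>j. [0, 0, 0, 3, 3, 3] ! j"
  proof
    show "inj_on (\<lambda>j. rows6 j t) {..<6}" for t by (rule inj_on_rows6)
    show "inj_on (\<lambda>t. (rows6 j t + t) mod ?n) {..<?n}" if "j < 6" for j
    proof (rule inj_on_rows6_shift)
      show "?n mod 3 = 1" by presburger
    qed (use that in simp_all)
    show "inj_on (\<lambda>j. [0, 3, 1, 2 :: nat] ! j) {..<4}" by (rule inj_on_nth) auto
    show "inj_on ?v {..<6 + 4}" by (rule inj_on_nth) auto
    show "6 * b + (\<Sum>j<6. [0, 0, 0, 3, 3, 3] ! j) < ?n" by (simp add: eval_nat_numeral)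
  next
    fix j t :: nat assume "j < 6"
    hence j: "j = 0 \<or> j = 1 \<or> j = 2 \<or> j = 3 \<or> j = 4 \<or> j = 5" by linarith
    show "rows6 j t < 6" "rows6 j t \<le> rows6 j j"
      "rows6 j j \<le> rows6 j t + [0, 0, 0, 3, 3, 3] ! j"
      using j by (elim disjE; simp add: rows6_def)+
    show "6 * b + rows6 j j + j = ?v j \<or> 6 * b + rows6 j j + j = ?n + ?v j"
      using j by (elim disjE) (simp_all add: rows6_def)
  next
    fix j :: nat assume "j < 4"
    hence "j = 0 \<or> j = 1 \<or> j = 2 \<or> j = 3" by linarith
    thus "[0, 3, 1, 2] ! j < (4::nat)"
      "2 * (3 * b + 6 + 3 * b) + [0, 3, 1, 2] ! j + j = ?n + ?v (6 + j)"
      by (elim disjE; simp)+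
  next
    fix j :: nat assume "j < 6 + 4"
    hence "j = 0 \<or> j = 1 \<or> j = 2 \<or> j = 3 \<or> j = 4 \<or> j = 5 \<or> j = 6 \<or> j = 7 \<or> j = 8 \<or> j = 9"
      by presburger
    thus "?v j < ?n" "?v j \<notin> {1..6 * b - 3} \<union> {1..6 * b}" by (elim disjE; simp)+
  qed simp_all
  have "b + card {3::nat} \<le> card {e. pinned ?n (shift_square ?n K) e}"
    by (rule card_pinned) (auto simp: rows6_def)
  thus ?thesis using latin_square_K by auto
qed

theorem theorem1:
  fixes n :: nat
  assumes "even n" and "n \<ge> 10"
  shows "\<exists>L. latin_square n L \<and> card {e. pinned n L e} \<ge> n div 6"
proof -
  obtain k where n: "n = 6 * k + n mod 6" by (metis mult_div_mod_eq)
  have "n mod 6 = 0 \<or> n mod 6 = 2 \<or> n mod 6 = 4" using assms(1) by presburger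
  then consider (0) b where "n = 6 * b + 12" | (2) b where "n = 6 * b + 14"
    | (4) b where "n = 6 * b + 10"
  proof (elim disjE)
    assume "n mod 6 = 0"
    \<comment> \<open>In this residue class \<open>n \<ge> 10\<close> forces
      \<open>k \<ge> 2\<close>, so the truncated subtraction is exact; the other two classes are
      similar.\<close>
    with n assms(2) have "n = 6 * (k - 2) + 12" by linarith
    thus thesis by (rule 0)
  next
    assume "n mod 6 = 2"
    with n assms(2) have "n = 6 * (k - 2) + 14" by linarith
    thus thesis by (rule 2)
  next
    assume "n mod 6 = 4"
    with n assms(2) have "n = 6 * (k - 1) + 10" by linarith
    thus thesis by (rule 4)
  qed
  thus ?thesis
  proof cases
    case 0
    moreover have "(6 * b + 12) div 6 = b + 2" for b :: nat by simp
    ultimately show ?thesis using latin_square_pinned4[of b] by simp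
  next
    case 2
    moreover have "(6 * b + 14) div 6 = b + 2" for b :: nat by simp
    ultimately show ?thesis using latin_square_pinned5[of b] by simp
  next
    case 4
    moreover have "(6 * b + 10) div 6 = b + 1" for b :: nat by simp
    ultimately show ?thesis using latin_square_pinned6[of b] by simp
  qed
qed

end
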